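(* Let $\nu\in[0,1/2)$, $n\in\mathbb{N}$. For every $\alpha>0$, let $(A^\alpha_n,B^\alpha_{n-1},C^\alpha_{n-1})$ be the type 1 multiple orthogonal polynomials for $(n,n-1,n-1)$ with parameter $\alpha$, with associated function $q^\alpha_{n,n-1,n-1}$, and let $(A^{\alpha-1}_n,B^{\alpha-1}_{n-1},C^{\alpha-1}_n)$ be the type 1 multiple orthogonal polynomials for $(n,n-1,n)$ with parameter $\alpha-1$, with associated function $q^{\alpha-1}_{n,n-1,n}$, where the multiplicative factor up to which the latter are determined is suitably chosen. Then $$\frac{d}{dx}\left[x^\alpha q^\alpha_{n,n-1,n-1}(x)\right]=x^{\alpha-1}q^{\alpha-1}_{n,n-1,n}(x),\qquad x>0,$$ and the following differential recurrence relations hold: $$A^{\alpha-1}_n(x)=(\alpha+2\nu)A^\alpha_n(x)+x\,[A^\alpha_n(x)]'-x\,C^\alpha_{n-1}(x),$$ $$B^{\alpha-1}_{n-1}(x)=\alpha B^\alpha_{n-1}(x)+x\,[B^\alpha_{n-1}(x)]'-C^\alpha_{n-1}(x),$$ $$C^{\alpha-1}_n(x)=(\alpha+\nu)C^\alpha_{n-1}(x)+x\,[C^\alpha_{n-1}(x)]'-2A^\alpha_n(x)-2x\,B^\alpha_{n-1}(x).$$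
   Context: For $x>0$, $\rho_\nu(x)=2x^{\nu/2}K_\nu(2\sqrt x)$, with $K_\nu$ the Macdonald function (modified Bessel function of the second kind). For $\alpha>-1$ and $l\in\{n-1,n\}$, type 1 multiple orthogonal polynomials for $(n,n-1,l)$ with parameter $\alpha$ are polynomials $A^\alpha_n,B^\alpha_{n-1},C^\alpha_l$, not all zero, of degrees at most $n$, $n-1$, $l$ respectively, such that the function $$q^\alpha_{n,n-1,l}(x)=A^\alpha_n(x)\rho_\nu^2(x)+B^\alpha_{n-1}(x)\rho_{\nu+1}^2(x)+C^\alpha_l(x)\rho_\nu(x)\rho_{\nu+1}(x)$$ satisfies $$\int_0^\infty q^\alpha_{n,n-1,l}(x)\,x^{\alpha+m}\,dx=0,\qquad m=0,1,\dots,2n+l .$$ (This is $3n$ conditions for $l=n-1$ and $3n+1$ conditions for $l=n$, one fewer than the number of unknown coefficients in each case.) They are considered as determined up to a common nonzero multiplicative factor. The prime denotes $d/dx$. *)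

theory Defs
  imports "HOL-Analysis.Analysis" "HOL-Computational_Algebra.Polynomial"
begin

(* The Macdonald function on the positive half-line, by its classical integral representation
   K_nu(z) = int_0^oo exp (- z cosh t) cosh (nu t) dt, which is valid for every real order
   (including integer orders) and every z > 0.  The integral converges for all z > 0; the values
   at z <= 0 are irrelevant. *)
definition macdonald_K :: "real \<Rightarrow> real \<Rightarrow> real" where
  "macdonald_K \<nu> z = integral {0..} (\<lambda>t. exp (- z * cosh t) * cosh (\<nu> * t))"

definition rho :: "real \<Rightarrow> real \<Rightarrow> real" where
  "rho \<nu> x = 2 * x powr (\<nu> / 2) * macdonald_K \<nu> (2 * sqrt x)"

definition type1_fun ::
  "real \<Rightarrow> real poly \<Rightarrow> real poly \<Rightarrow> real poly \<Rightarrow> real \<Rightarrow> real" where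
  "type1_fun \<nu> A B C x =
     poly A x * (rho \<nu> x)\<^sup>2 + poly B x * (rho (\<nu> + 1) x)\<^sup>2
       + poly C x * rho \<nu> x * rho (\<nu> + 1) x"

(* Type 1 multiple orthogonal polynomials for (n, n-1, l) with parameter alpha.
   Meant for n >= 1 (so that n - 1 is not truncated), l = n - 1 or l = n, and alpha > -1;
   in that range the integrals below converge absolutely for all A, B, C. *)
definition type1_mop ::
  "real \<Rightarrow> nat \<Rightarrow> nat \<Rightarrow> real \<Rightarrow> real poly \<Rightarrow> real poly \<Rightarrow> real poly \<Rightarrow> bool" where
  "type1_mop \<nu> n l \<alpha> A B C \<longleftrightarrow>
     \<not> (A = 0 \<and> B = 0 \<and> C = 0) \<and>
     degree A \<le> n \<and> degree B \<le> n - 1 \<and> degree C \<le> l \<and>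
     (\<forall>m\<le>2 * n + l.
        ((\<lambda>x. type1_fun \<nu> A B C x * x powr (\<alpha> + real m)) has_integral 0) {0<..})"

end

theory Submission
  imports Defs
begin

text \<open>
  Integrating \<open>d/dx (x powr s * type1_fun \<nu> A B C x)\<close> over the half-line shows that the Mellin
  transforms of \<open>\<rho>\<^sub>\<nu>\<^sup>2\<close>, \<open>\<rho>\<^sub>\<nu>\<^sub>+\<^sub>1\<^sup>2\<close> and \<open>\<rho>\<^sub>\<nu> \<rho>\<^sub>\<nu>\<^sub>+\<^sub>1\<close> are rational multiples of that of
  \<open>\<rho>\<^sub>\<nu>\<^sup>2\<close>, which satisfies a first-order rational recurrence in \<open>s\<close>. Hence the Mellin transform of a
  type 1 function for \<open>(n, n - 1, n)\<close> is a fixed nonvanishing function times a polynomial in \<open>s\<close> of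
  degree at most \<open>3 n + 1\<close>, and evaluating at \<open>s = - 2 \<nu>, - \<nu>, 0\<close> shows inductively that this
  polynomial determines the coefficients (here \<open>\<nu> < 1 / 2\<close>
  enters). The \<open>3 n + 1\<close> orthogonality conditions prescribe that
  many zeros of the polynomial, so the type 1 polynomials for \<open>(n, n - 1, n)\<close> are unique up to a
  factor; and differentiation multiplies the Mellin transform by \<open>\<alpha> - s\<close>, which turns the
  conditions for \<open>(n, n - 1, n - 1)\<close> and \<open>\<alpha>\<close> into those for \<open>(n, n - 1, n)\<close> and \<open>\<alpha> - 1\<close>.
\<close>

section \<open>Integration over half-lines and an elementary bound\<close>

text \<open>Serves both integrations by parts below: in \<open>t\<close> for the order recurrence of
  \<open>macdonald_K\<close>, and in \<open>x\<close> for Mellin transforms. Only one-sided limits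
  of \<open>F\<close> enter, so \<open>F\<close> may be undefined or irregular at 0.\<close>

lemma has_integral_FTC_Ioi:
  fixes F f :: "real \<Rightarrow> real"
  assumes deriv: "\<And>x. x > 0 \<Longrightarrow> (F has_real_derivative f x) (at x)"
    and cont: "continuous_on {0<..} f"
    and int: "f absolutely_integrable_on {0<..}"
    and lim0: "(F \<longlongrightarrow> a) (at_right 0)" and liminf: "(F \<longlongrightarrow> b) at_top"
  shows "(f has_integral b - a) {0<..}"
proof -
  \<comment> \<open>Absolute integrability lives on the Lebesgue completion; continuity supplies the
    Borel measurability that allows passing to \<open>lborel\<close>.\<close>
  have meas: "(\<lambda>x. indicator {0<..} x *\<^sub>R f x) \<in> borel_measurable borel"
    using cont by (intro borel_measurable_continuous_on_indicator) auto
  have si: "set_integrable lborel {0<..} f"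
    using int meas unfolding set_integrable_def by (simp add: integrable_completion)
  have "(LBINT x=0..\<infinity>. f x) = b - a"
  proof (rule interval_integral_FTC_integrable[where F = F])
    show "(F has_vector_derivative f x) (at x)" if "0 < ereal x" for x
      using deriv[of x] that by (simp add: has_real_derivative_iff_has_vector_derivative)
    show "isCont f x" if "0 < ereal x" for x
      using cont that by (simp add: continuous_on_eq_continuous_at)
    show "set_integrable lborel (einterval 0 \<infinity>) f"
      using si by (simp add: zero_ereal_def)
    show "((F \<circ> real_of_ereal) \<longlongrightarrow> a) (at_right 0)"
      using lim0 by (simp add: zero_ereal_def ereal_tendsto_simps)
    show "((F \<circ> real_of_ereal) \<longlongrightarrow> b) (at_left \<infinity>)"
      using liminf by (simp add: ereal_tendsto_simps)
  qed simp_all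
  then show ?thesis
    using set_borel_integral_eq_integral[OF si] interval_lebesgue_integral_0_infty(2)[of lborel f]
    by (simp add: has_integral_integrable_integral)
qed

lemma absolutely_integrable_continuous_dominated:
  fixes f g :: "real \<Rightarrow> real"
  assumes "S \<in> sets lebesgue" "continuous_on S f" "g integrable_on S"
    and "\<And>x. x \<in> S \<Longrightarrow> \<bar>f x\<bar> \<le> g x"
  shows "f absolutely_integrable_on S"
  using assms
  by (intro measurable_bounded_by_integrable_imp_absolutely_integrable[where g = g]
      continuous_imp_measurable_on_sets_lebesgue) auto

text \<open>Raise \<open>1 + u \<le> exp u\<close> at \<open>u = y / p\<close> to the power
  \<open>p\<close>. This trades exponential decay for any chosen power.\<close>

lemma exp_minus_le_powr:
  fixes y p :: real
  assumes "y > 0" "p > 0"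
  shows "exp (- y) \<le> (p / y) powr p"
proof -
  have "y / p \<le> exp (y / p)"
    using exp_ge_add_one_self[of "y / p"] by linarith
  then have "(y / p) powr p \<le> exp (y / p) powr p"
    using assms by (intro powr_mono2) auto
  also have "\<dots> = exp y"
    using assms by (simp add: powr_def)
  finally have "inverse (exp y) \<le> inverse ((y / p) powr p)"
    using assms by (intro le_imp_inverse_le) auto
  then show ?thesis
    using assms by (simp add: exp_minus powr_divide)
qed

subsection \<open>The Macdonald function\<close>

lemma cosh_le_exp_abs:
  fixes \<mu> t :: real
  assumes "t \<ge> 0"
  shows "cosh (\<mu> * t) \<le> exp (\<bar>\<mu>\<bar> * t)"
proof -
  have "exp (\<mu> * t) \<le> exp (\<bar>\<mu>\<bar> * t)" "exp (- (\<mu> * t)) \<le> exp (\<bar>\<mu>\<bar> * t)"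
    using assms mult_right_mono[of \<mu> "\<bar>\<mu>\<bar>" t] mult_right_mono[of "- \<mu>" "\<bar>\<mu>\<bar>" t] by auto
  from add_mono[OF this] show ?thesis
    by (simp add: cosh_field_def field_simps del: exp_le_cancel_iff)
qed

text \<open>Since \<open>cosh t\<close> is at least \<open>exp t / 2\<close>, a power of
  \<open>exp t\<close> in the previous bound becomes exponential decay in \<open>t\<close>. The free
  \<open>p\<close> fixes both the rate in \<open>t\<close> and the power of
  \<open>z\<close>.\<close>

lemma exp_cosh_decay:
  fixes z p t :: real
  assumes "z > 0" "p > 0"
  shows "exp (- z * cosh t) \<le> (2 * p / z) powr p * exp (- p * t)"
proof -
  have "exp t / 2 \<le> cosh t"
    by (simp add: cosh_field_def)
  then have "z * (exp t / 2) \<le> z * cosh t"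
    using assms by (intro mult_left_mono) auto
  then have "exp (- z * cosh t) \<le> exp (- (z * (exp t / 2)))"
    by simp
  also have "\<dots> \<le> (p / (z * (exp t / 2))) powr p"
    using assms by (intro exp_minus_le_powr) auto
  also have "\<dots> = (2 * p / z * exp (- t)) powr p"
    by (simp add: exp_minus field_simps)
  also have "\<dots> = (2 * p / z) powr p * exp (- p * t)"
    using assms by (subst powr_mult) (auto simp: powr_def)
  finally show ?thesis .
qed

lemma macdonald_integrand_decay:
  fixes z p t \<mu> :: real
  assumes "z > 0" "p > 0" "t \<ge> 0"
  shows "exp (- z * cosh t) * cosh (\<mu> * t) \<le> (2 * p / z) powr p * exp (- (p - \<bar>\<mu>\<bar>) * t)"
proof -
  have "exp (- z * cosh t) * cosh (\<mu> * t)
      \<le> (2 * p / z) powr p * exp (- p * t) * exp (\<bar>\<mu>\<bar> * t)"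
    using assms exp_cosh_decay[of z p t] cosh_le_exp_abs[of t \<mu>]
    by (intro mult_mono) auto
  also have "\<dots> = (2 * p / z) powr p * exp (- (p - \<bar>\<mu>\<bar>) * t)"
    by (simp add: algebra_simps flip: exp_add)
  finally show ?thesis .
qed

lemma macdonald_integrand_absolutely_integrable:
  fixes z \<mu> :: real
  assumes "z > 0"
  shows "(\<lambda>t. exp (- z * cosh t) * cosh (\<mu> * t)) absolutely_integrable_on {0..}"
proof (rule absolutely_integrable_continuous_dominated)
  \<comment> \<open>With this \<open>p\<close> the majorant decays like
    \<open>exp (- t)\<close>.\<close>
  define p where "p = \<bar>\<mu>\<bar> + 1"
  show "(\<lambda>t. (2 * p / z) powr p * exp (- (p - \<bar>\<mu>\<bar>) * t)) integrable_on {0..}"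
    using integrable_on_exp_minus_to_infinity[of 1 0]
    by (intro integrable_on_mult_right) (simp add: p_def)
  show "\<bar>exp (- z * cosh t) * cosh (\<mu> * t)\<bar> \<le> (2 * p / z) powr p * exp (- (p - \<bar>\<mu>\<bar>) * t)"
    if "t \<in> {0..}" for t
    using macdonald_integrand_decay[of z p t \<mu>] that assms by (simp add: p_def abs_mult)
qed (auto intro!: continuous_intros)

lemma macdonald_integrand_integrable:
  fixes z \<mu> :: real
  assumes "z > 0"
  shows "(\<lambda>t. exp (- z * cosh t) * cosh (\<mu> * t)) integrable_on {0..}"
  using macdonald_integrand_absolutely_integrable[OF assms] absolutely_integrable_on_def by blast

text \<open>Integrates the pointwise bound. Keeping \<open>p\<close> free yields decay of any high
  order in \<open>z\<close>, and near 0 a singularity of order only slightly above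
  \<open>\<bar>\<mu>\<bar>\<close>.\<close>

lemma macdonald_K_upper:
  assumes "z > 0" "p > \<bar>\<mu>\<bar>"
  shows "macdonald_K \<mu> z \<le> (2 * p / z) powr p / (p - \<bar>\<mu>\<bar>)"
proof -
  have hi: "((\<lambda>t. (2 * p / z) powr p * exp (- (p - \<bar>\<mu>\<bar>) * t))
      has_integral (2 * p / z) powr p * (exp (- (p - \<bar>\<mu>\<bar>) * 0) / (p - \<bar>\<mu>\<bar>))) {0..}"
    using assms by (intro has_integral_mult_right has_integral_exp_minus_to_infinity) auto
  have "macdonald_K \<mu> z \<le> (2 * p / z) powr p * (exp (- (p - \<bar>\<mu>\<bar>) * 0) / (p - \<bar>\<mu>\<bar>))"
    unfolding macdonald_K_def
    using assms macdonald_integrand_decay[of z p _ \<mu>]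
    by (intro has_integral_le[OF integrable_integral[OF macdonald_integrand_integrable] hi]) auto
  then show ?thesis
    by simp
qed

text \<open>Restrict the integral to \<open>{0..1}\<close>, where
  \<open>cosh t \<le> cosh 1\<close>. Its purpose is strict positivity.\<close>

lemma macdonald_K_lower:
  assumes "z > 0"
  shows "exp (- z * cosh 1) \<le> macdonald_K \<mu> z"
proof -
  have hi: "((\<lambda>t. exp (- z * cosh 1)) has_integral exp (- z * cosh 1)) {0..1::real}"
    using has_integral_const_real[of "exp (- z * cosh 1)" 0 1] by simp
  have int01: "(\<lambda>t. exp (- z * cosh t) * cosh (\<mu> * t)) integrable_on {0..1}"
    by (intro integrable_continuous_interval continuous_intros)
  have "exp (- z * cosh 1) \<le> integral {0..1} (\<lambda>t. exp (- z * cosh t) * cosh (\<mu> * t))"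
  proof (rule has_integral_le[OF hi integrable_integral[OF int01]])
    fix t :: real assume "t \<in> {0..1}"
    then have "cosh t \<le> cosh 1" by (simp add: cosh_real_nonneg_le_iff)
    then have "exp (- z * cosh 1) \<le> exp (- z * cosh t)" using assms by simp
    then show "exp (- z * cosh 1) \<le> exp (- z * cosh t) * cosh (\<mu> * t)"
      using mult_mono[of "exp (- z * cosh 1)" "exp (- z * cosh t)" 1 "cosh (\<mu> * t)"]
      by (simp add: cosh_real_ge_1)
  qed
  also have "\<dots> \<le> macdonald_K \<mu> z"
    unfolding macdonald_K_def using assms
    by (intro integral_subset_le int01 macdonald_integrand_integrable) auto
  finally show ?thesis .
qed

text \<open>The integrand is an exponential in \<open>z\<close>, hence lies above its tangent line.
  The factor \<open>cosh t\<close> produced by the slope is absorbed by the addition formula,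
  \<open>2 * cosh t * cosh (\<mu> * t)\<close> being the sum of the integrands' factors of orders
  \<open>\<mu> + 1\<close> and \<open>\<mu> - 1\<close>.\<close>

lemma macdonald_K_subgradient:
  assumes "z > 0" "w > 0"
  shows "macdonald_K \<mu> z - (w - z) * ((macdonald_K (\<mu> + 1) z + macdonald_K (\<mu> - 1) z) / 2)
    \<le> macdonald_K \<mu> w"
proof -
  define k where "k = (\<lambda>\<mu> z t::real. exp (- z * cosh t) * cosh (\<mu> * t))"
  have hK: "(k \<mu> z has_integral macdonald_K \<mu> z) {0..}" if "z > 0" for \<mu> z
    using macdonald_integrand_integrable[OF that, of \<mu>]
    by (simp add: macdonald_K_def k_def has_integral_integrable_integral)
  have "((\<lambda>t. k \<mu> z t - (w - z) * ((k (\<mu> + 1) z t + k (\<mu> - 1) z t) / 2)) has_integral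
      (macdonald_K \<mu> z - (w - z) * ((macdonald_K (\<mu> + 1) z + macdonald_K (\<mu> - 1) z) / 2))) {0..}"
    by (intro has_integral_diff has_integral_mult_right has_integral_divide has_integral_add hK assms)
  then show ?thesis
  proof (rule has_integral_le[OF _ hK[OF assms(2)]])
    fix t :: real assume "t \<in> {0..}"
    have "k (\<mu> + 1) z t + k (\<mu> - 1) z t = 2 * cosh t * k \<mu> z t"
      by (simp add: k_def cosh_add cosh_diff algebra_simps)
    then have "k \<mu> z t - (w - z) * ((k (\<mu> + 1) z t + k (\<mu> - 1) z t) / 2)
        = k \<mu> z t * (1 + - (w - z) * cosh t)"
      by (simp add: algebra_simps)
    also have "\<dots> \<le> k \<mu> z t * exp (- (w - z) * cosh t)"
      by (intro mult_left_mono exp_ge_add_one_self) (simp add: k_def)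
    also have "\<dots> = k \<mu> w t"
      by (simp add: k_def mult_ac exp_add[symmetric] algebra_simps flip: exp_add)
    finally show "k \<mu> z t - (w - z) * ((k (\<mu> + 1) z t + k (\<mu> - 1) z t) / 2) \<le> k \<mu> w t" .
  qed
qed

text \<open>A function with a supporting line at every point is convex: average the inequalities
  based at the convex combination \<open>m\<close>, and the slopes cancel. Convexity on an open
  interval gives continuity.\<close>

lemma continuous_on_macdonald_K: "continuous_on {0<..} (macdonald_K \<mu>)"
proof (rule convex_on_continuous)
  show "convex_on {0<..} (macdonald_K \<mu>)"
  proof (rule convex_onI)
    fix u x y :: real
    assume u: "0 < u" "u < 1" and xy: "x \<in> {0<..}" "y \<in> {0<..}"
    define m where "m = (1 - u) *\<^sub>R x + u *\<^sub>R y"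
    define L where "L = (macdonald_K (\<mu> + 1) m + macdonald_K (\<mu> - 1) m) / 2"
    have "m > 0"
      using u xy by (simp add: m_def add_pos_pos)
    then have "macdonald_K \<mu> m - (x - m) * L \<le> macdonald_K \<mu> x"
      "macdonald_K \<mu> m - (y - m) * L \<le> macdonald_K \<mu> y"
      using macdonald_K_subgradient xy by (auto simp: L_def)
    then have "(1 - u) * (macdonald_K \<mu> m - (x - m) * L) + u * (macdonald_K \<mu> m - (y - m) * L)
        \<le> (1 - u) * macdonald_K \<mu> x + u * macdonald_K \<mu> y"
      using u by (intro add_mono mult_left_mono) auto
    also have "(1 - u) * (macdonald_K \<mu> m - (x - m) * L) + u * (macdonald_K \<mu> m - (y - m) * L)
        = macdonald_K \<mu> m - ((1 - u) * x + u * y - m) * L"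
      by (simp add: algebra_simps)
    also have "\<dots> = macdonald_K \<mu> m"
      by (simp add: m_def)
    finally show "macdonald_K \<mu> ((1 - u) *\<^sub>R x + u *\<^sub>R y)
        \<le> (1 - u) * macdonald_K \<mu> x + u * macdonald_K \<mu> y"
      by (simp add: m_def)
  qed simp
qed simp

text \<open>Convexity squeezes the difference quotient between two values of the (continuous) formal
  derivative, which avoids differentiating under the integral sign.\<close>

lemma has_real_derivative_macdonald_K:
  assumes "z > 0"
  shows "(macdonald_K \<mu> has_real_derivative
    - ((macdonald_K (\<mu> + 1) z + macdonald_K (\<mu> - 1) z) / 2)) (at z)"
proof -
  define L where "L = (\<lambda>z. (macdonald_K (\<mu> + 1) z + macdonald_K (\<mu> - 1) z) / 2)"
  have "continuous_on {0<..} L"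
    unfolding L_def by (intro continuous_intros continuous_on_macdonald_K) auto
  then have "isCont L z"
    using assms by (simp add: continuous_on_eq_continuous_at)
  then have lim: "((\<lambda>w. L w - L z) \<longlongrightarrow> 0) (at z)"
    by (simp add: isCont_def LIM_zero_iff)
  have bound: "\<bar>(macdonald_K \<mu> w - macdonald_K \<mu> z) / (w - z) + L z\<bar> \<le> \<bar>L w - L z\<bar>"
    if "w > 0" "w \<noteq> z" for w
  proof -
    \<comment> \<open>The subgradient inequalities based at \<open>z\<close> and at \<open>w\<close>
      trap \<open>D\<close> between 0 and \<open>(w - z) * (L z - L w)\<close>.\<close>
    define D where "D = macdonald_K \<mu> w - macdonald_K \<mu> z + (w - z) * L z"
    have "macdonald_K \<mu> z - (w - z) * L z \<le> macdonald_K \<mu> w"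
      unfolding L_def by (rule macdonald_K_subgradient[OF assms that(1)])
    moreover have "macdonald_K \<mu> w - (z - w) * L w \<le> macdonald_K \<mu> z"
      unfolding L_def by (rule macdonald_K_subgradient[OF that(1) assms])
    ultimately have "0 \<le> D" "D \<le> (w - z) * (L z - L w)"
      unfolding D_def by (simp_all add: algebra_simps)
    then have "\<bar>D\<bar> \<le> \<bar>w - z\<bar> * \<bar>L w - L z\<bar>"
      unfolding abs_mult[symmetric] by (simp add: algebra_simps abs_le_iff)
    moreover have "(macdonald_K \<mu> w - macdonald_K \<mu> z) / (w - z) + L z = D / (w - z)"
      using that by (simp add: D_def field_simps)
    ultimately show ?thesis
      using that by (simp add: abs_divide divide_le_eq mult.commute)
  qed
  have "eventually (\<lambda>w. w > 0) (at z)"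
    using assms eventually_at_in_open'[of "{0<..}" z] by auto
  then have "eventually (\<lambda>w. norm ((macdonald_K \<mu> w - macdonald_K \<mu> z) / (w - z) + L z)
      \<le> norm (L w - L z)) (at z)"
    using eventually_neq_at_within[of z z UNIV]
    by eventually_elim (use bound in auto)
  then have "((\<lambda>w. (macdonald_K \<mu> w - macdonald_K \<mu> z) / (w - z) + L z) \<longlongrightarrow> 0) (at z)"
    by (rule Lim_null_comparison[OF _ tendsto_norm_zero[OF lim]])
  then have "((\<lambda>w. (macdonald_K \<mu> w - macdonald_K \<mu> z) / (w - z)) \<longlongrightarrow> - L z) (at z)"
    using tendsto_diff[OF _ tendsto_const[of "L z"]] by fastforce
  then show ?thesis
    by (simp add: has_field_derivative_iff L_def)
qed

text \<open>Integrate the derivative of \<open>exp (- z * cosh t) * sinh (\<mu> * t)\<close>: the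
  boundary values vanish, at 0 through \<open>sinh\<close> and at infinity through the exponential,
  and \<open>sinh t * sinh (\<mu> * t)\<close> is half a difference of the hyperbolic cosines of
  orders \<open>\<mu> + 1\<close> and \<open>\<mu> - 1\<close>.\<close>

lemma macdonald_K_recurrence:
  assumes "z > 0"
  shows "macdonald_K (\<mu> + 1) z - macdonald_K (\<mu> - 1) z = 2 * \<mu> / z * macdonald_K \<mu> z"
proof -
  define k where "k = (\<lambda>\<mu> t::real. exp (- z * cosh t) * cosh (\<mu> * t))"
  define F where "F = (\<lambda>t. exp (- z * cosh t) * sinh (\<mu> * t))"
  define f where "f = (\<lambda>t. \<mu> * k \<mu> t - z / 2 * (k (\<mu> + 1) t - k (\<mu> - 1) t))"
  have ai: "k \<mu> absolutely_integrable_on {0<..}" for \<mu>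
    using macdonald_integrand_absolutely_integrable[OF assms, of \<mu>]
    unfolding k_def by (rule set_integrable_subset) auto
  have hK: "(k \<mu> has_integral macdonald_K \<mu> z) {0<..}" for \<mu>
  proof -
    have "(k \<mu> has_integral macdonald_K \<mu> z) {0..}"
      using macdonald_integrand_integrable[OF assms, of \<mu>]
      by (simp add: macdonald_K_def k_def has_integral_integrable_integral)
    moreover have "{0::real..} - {0<..} = {0}" "{0::real<..} - {0..} = {}" by auto
    ultimately show ?thesis
      by (subst has_integral_spike_set_eq[of _ "{0..}"]) (auto intro: negligible_subset[of "{0}"])
  qed
  have int0: "(f has_integral 0 - 0) {0<..}"
  proof (rule has_integral_FTC_Ioi)
    show "(F has_real_derivative f t) (at t)" for t
      unfolding F_def f_def k_def
      by (auto intro!: derivative_eq_intros simp: algebra_simps cosh_add cosh_diff)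
    show "continuous_on {0<..} f"
      unfolding f_def k_def by (auto intro!: continuous_intros)
    show "f absolutely_integrable_on {0<..}"
      unfolding f_def by (intro set_integral_diff set_integrable_mult_right ai)
    have "isCont F 0"
      unfolding F_def by (auto intro!: continuous_intros)
    then have "(F \<longlongrightarrow> 0) (at 0)"
      by (simp add: F_def isCont_def)
    then show "(F \<longlongrightarrow> 0) (at_right 0)"
      by (rule filterlim_mono) (auto simp: at_within_le_at)
    define p where "p = \<bar>\<mu>\<bar> + 1"
    have "((\<lambda>t. (2 * p / z) powr p * exp (- t)) \<longlongrightarrow> (2 * p / z) powr p * 0) at_top"
      by (intro tendsto_intros filterlim_compose[OF exp_at_bot] filterlim_uminus_at_bot_at_top)
    then have lim: "((\<lambda>t. (2 * p / z) powr p * exp (- t)) \<longlongrightarrow> 0) at_top"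
      by simp
    show "(F \<longlongrightarrow> 0) at_top"
    proof (rule Lim_null_comparison[OF _ lim])
      have "norm (F t) \<le> (2 * p / z) powr p * exp (- t)" if "t \<ge> 0" for t
      proof -
        have "\<bar>sinh (\<mu> * t)\<bar> \<le> cosh (\<mu> * t)"
          by (simp add: sinh_field_def cosh_field_def abs_le_iff)
        then have "norm (F t) \<le> exp (- z * cosh t) * cosh (\<mu> * t)"
          by (simp add: F_def abs_mult)
        also have "\<dots> \<le> (2 * p / z) powr p * exp (- t)"
          using macdonald_integrand_decay[of z p t \<mu>] assms that by (simp add: p_def)
        finally show ?thesis .
      qed
      then show "\<forall>\<^sub>F t in at_top. norm (F t) \<le> (2 * p / z) powr p * exp (- t)"
        using eventually_at_top_linorder by blast
    qed
  qed
  have "(f has_integral \<mu> * macdonald_K \<mu> z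
      - z / 2 * (macdonald_K (\<mu> + 1) z - macdonald_K (\<mu> - 1) z)) {0<..}"
    unfolding f_def by (intro has_integral_diff has_integral_mult_right hK)
  from has_integral_unique[OF int0 this] have "\<mu> * macdonald_K \<mu> z = z / 2 * (macdonald_K (\<mu> + 1) z - macdonald_K (\<mu> - 1) z)"
    by simp
  then show ?thesis
    using assms by (simp add: field_simps)
qed

section \<open>The functions \<open>rho\<close> and their derivatives\<close>

lemma rho_pos: "x > 0 \<Longrightarrow> rho \<mu> x > 0"
  using less_le_trans[OF exp_gt_zero macdonald_K_lower[of "2 * sqrt x" \<mu>]]
  unfolding rho_def by (intro mult_pos_pos) simp_all

lemma has_real_derivative_rho_aux:
  assumes "x > 0"
  shows "(rho \<mu> has_real_derivative \<mu> * x powr (\<mu> / 2 - 1) * macdonald_K \<mu> (2 * sqrt x)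
    - x powr (\<mu> / 2 - 1 / 2) * (macdonald_K (\<mu> + 1) (2 * sqrt x) + macdonald_K (\<mu> - 1) (2 * sqrt x)))
    (at x)"
proof -
  have half: "x powr (\<mu> / 2) / sqrt x = x powr (\<mu> / 2 - 1 / 2)"
    using assms by (simp add: powr_diff powr_half_sqrt)
  have "((\<lambda>x. 2 * sqrt x) has_real_derivative 1 / sqrt x) (at x)"
    using assms by (auto intro!: derivative_eq_intros simp: field_simps)
  from DERIV_chain2[OF has_real_derivative_macdonald_K[of "2 * sqrt x" \<mu>] this]
  have d: "((\<lambda>x. macdonald_K \<mu> (2 * sqrt x)) has_real_derivative
    - ((macdonald_K (\<mu> + 1) (2 * sqrt x) + macdonald_K (\<mu> - 1) (2 * sqrt x)) / 2) * (1 / sqrt x)) (at x)"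
    using assms by simp
  have "((\<lambda>x. 2 * x powr (\<mu> / 2)) has_real_derivative \<mu> * x powr (\<mu> / 2 - 1)) (at x)"
    using DERIV_cmult[OF has_real_derivative_powr[OF assms, of "\<mu> / 2"], of 2] by simp
  from DERIV_mult[OF this d] show ?thesis
    unfolding rho_def[abs_def] half[symmetric] using assms by (elim DERIV_cong) (simp add: field_simps)
qed

text \<open>The recurrence eliminates order \<open>\<mu> - 1\<close>. With the next lemma, the
  derivatives of \<open>rho \<nu>\<close> and \<open>rho (\<nu> + 1)\<close> are combinations of
  these two functions alone, so type 1 functions are stable under \<open>x\<close> times
  differentiation.\<close>

lemma has_real_derivative_rho:
  assumes "x > 0"
  shows "(rho \<mu> has_real_derivative (\<mu> * rho \<mu> x - rho (\<mu> + 1) x) / x) (at x)"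
proof -
  define K where "K = (\<lambda>\<mu>. macdonald_K \<mu> (2 * sqrt x))"
  have rho: "rho \<mu> x = 2 * x powr (\<mu> / 2) * K \<mu>" for \<mu>
    by (simp add: rho_def K_def)
  have K: "K (\<mu> - 1) = K (\<mu> + 1) - \<mu> / sqrt x * K \<mu>"
    using macdonald_K_recurrence[of "2 * sqrt x" \<mu>] assms by (simp add: K_def)
  have p1: "x powr (\<mu> / 2 - 1 / 2) / sqrt x = x powr (\<mu> / 2) / x"
    using assms by (simp add: powr_diff powr_half_sqrt)
  have p2: "x powr ((\<mu> + 1) / 2) / x = x powr (\<mu> / 2 - 1 / 2)"
    using assms powr_diff[of x "(\<mu> + 1) / 2" 1] by (simp add: field_simps)
  have "\<mu> * x powr (\<mu> / 2 - 1) * K \<mu> - x powr (\<mu> / 2 - 1 / 2) * (K (\<mu> + 1) + K (\<mu> - 1))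
      = \<mu> * (x powr (\<mu> / 2) / x) * K \<mu> - 2 * x powr (\<mu> / 2 - 1 / 2) * K (\<mu> + 1)
        + \<mu> * (x powr (\<mu> / 2 - 1 / 2) / sqrt x) * K \<mu>"
    unfolding K using assms by (simp add: powr_diff algebra_simps)
  also have "\<dots> = (\<mu> * rho \<mu> x - rho (\<mu> + 1) x) / x"
    unfolding rho p1 by (simp add: diff_divide_distrib flip: p2)
  finally show ?thesis
    using has_real_derivative_rho_aux[OF assms, of \<mu>] by (simp add: K_def)
qed

text \<open>Here the recurrence eliminates the upper order \<open>\<mu> + 2\<close>, and the terms
  in \<open>rho (\<mu> + 1)\<close> cancel.\<close>

lemma has_real_derivative_rho_Suc:
  assumes "x > 0"
  shows "(rho (\<mu> + 1) has_real_derivative - rho \<mu> x) (at x)"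
proof -
  define K where "K = (\<lambda>\<mu>. macdonald_K \<mu> (2 * sqrt x))"
  have K: "K (\<mu> + 1 + 1) = K \<mu> + (\<mu> + 1) / sqrt x * K (\<mu> + 1)"
    using macdonald_K_recurrence[of "2 * sqrt x" "\<mu> + 1"] assms
    by (simp add: K_def field_simps)
  have p1: "x powr ((\<mu> + 1) / 2 - 1) = x powr (\<mu> / 2) / sqrt x"
    using assms powr_diff[of x "\<mu> / 2" "1 / 2"] by (simp add: powr_half_sqrt field_simps)
  have p2: "x powr ((\<mu> + 1) / 2 - 1 / 2) = x powr (\<mu> / 2)"
    by (simp add: field_simps)
  have "(\<mu> + 1) * x powr ((\<mu> + 1) / 2 - 1) * K (\<mu> + 1)
      - x powr ((\<mu> + 1) / 2 - 1 / 2) * (K (\<mu> + 1 + 1) + K (\<mu> + 1 - 1)) = - rho \<mu> x"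
    unfolding K p1 p2 by (simp add: rho_def K_def algebra_simps)
  then show ?thesis
    using has_real_derivative_rho_aux[OF assms, of "\<mu> + 1"] by (simp add: K_def)
qed

subsection \<open>Functions dominated by every negative power\<close>

text \<open>Quantifying over all \<open>q\<close> handles both ends at once: small \<open>q\<close>
  allows the logarithm of \<open>rho 0\<close> at 0, large \<open>q\<close> forces rapid decay at
  infinity. The class is stable under products and polynomial factors.\<close>

definition subpower :: "(real \<Rightarrow> real) \<Rightarrow> bool" where
  "subpower f \<longleftrightarrow> continuous_on {0<..} f \<and> (\<forall>q>0. \<exists>C. \<forall>x>0. \<bar>f x\<bar> \<le> C * x powr (- q))"

lemma subpowerD:
  assumes "subpower f" "q > 0"
  obtains C where "\<And>x. x > 0 \<Longrightarrow> \<bar>f x\<bar> \<le> C * x powr (- q)"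
  using assms unfolding subpower_def by blast

lemma subpower_continuous: "subpower f \<Longrightarrow> continuous_on {0<..} f"
  by (simp add: subpower_def)

lemma subpower_mult:
  assumes "subpower f" "subpower g"
  shows "subpower (\<lambda>x. f x * g x)"
  unfolding subpower_def
proof (intro conjI allI impI)
  show "continuous_on {0<..} (\<lambda>x. f x * g x)"
    by (intro continuous_intros subpower_continuous assms)
  fix q :: real assume "q > 0"
  then have "q / 2 > 0" by simp
  obtain C where C: "\<And>x. x > 0 \<Longrightarrow> \<bar>f x\<bar> \<le> C * x powr (- (q / 2))"
    using subpowerD[OF assms(1) \<open>q / 2 > 0\<close>] by blast
  obtain D where D: "\<And>x. x > 0 \<Longrightarrow> \<bar>g x\<bar> \<le> D * x powr (- (q / 2))"
    using subpowerD[OF assms(2) \<open>q / 2 > 0\<close>] by blast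
  have "\<bar>f x * g x\<bar> \<le> C * D * x powr (- q)" if "x > 0" for x
  proof -
    have "\<bar>f x * g x\<bar> \<le> (C * x powr (- (q / 2))) * (D * x powr (- (q / 2)))"
      unfolding abs_mult using C[OF that] D[OF that]
      by (intro mult_mono) (auto intro: order_trans[OF abs_ge_zero])
    also have "\<dots> = C * D * (x powr (- (q / 2)) * x powr (- (q / 2)))"
      by (simp add: mult_ac)
    also have "x powr (- (q / 2)) * x powr (- (q / 2)) = x powr (- q)"
      by (simp flip: powr_add)
    finally show ?thesis .
  qed
  then show "\<exists>C. \<forall>x>0. \<bar>f x * g x\<bar> \<le> C * x powr (- q)"
    by blast
qed

lemma subpower_add:
  assumes "subpower f" "subpower g"
  shows "subpower (\<lambda>x. f x + g x)"
  unfolding subpower_def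
proof (intro conjI allI impI)
  show "continuous_on {0<..} (\<lambda>x. f x + g x)"
    by (intro continuous_intros subpower_continuous assms)
  fix q :: real assume q: "q > 0"
  obtain C where C: "\<And>x. x > 0 \<Longrightarrow> \<bar>f x\<bar> \<le> C * x powr (- q)"
    using subpowerD[OF assms(1) q] by blast
  obtain D where D: "\<And>x. x > 0 \<Longrightarrow> \<bar>g x\<bar> \<le> D * x powr (- q)"
    using subpowerD[OF assms(2) q] by blast
  have "\<bar>f x + g x\<bar> \<le> (C + D) * x powr (- q)" if "x > 0" for x
    using abs_triangle_ineq[of "f x" "g x"] C[OF that] D[OF that] by (simp add: distrib_right)
  then show "\<exists>C. \<forall>x>0. \<bar>f x + g x\<bar> \<le> C * x powr (- q)"
    by blast
qed

lemma subpower_cmult: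
  assumes "subpower f"
  shows "subpower (\<lambda>x. c * f x)"
  unfolding subpower_def
proof (intro conjI allI impI)
  show "continuous_on {0<..} (\<lambda>x. c * f x)"
    by (intro continuous_intros subpower_continuous assms)
  fix q :: real assume q: "q > 0"
  obtain C where C: "\<And>x. x > 0 \<Longrightarrow> \<bar>f x\<bar> \<le> C * x powr (- q)"
    using subpowerD[OF assms(1) q] by blast
  have "\<bar>c * f x\<bar> \<le> \<bar>c\<bar> * C * x powr (- q)" if "x > 0" for x
    using mult_left_mono[OF C[OF that], of "\<bar>c\<bar>"] by (simp add: abs_mult mult.assoc)
  then show "\<exists>C. \<forall>x>0. \<bar>c * f x\<bar> \<le> C * x powr (- q)"
    by blast
qed

lemma subpower_times_self:
  assumes "subpower f"
  shows "subpower (\<lambda>x. x * f x)"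
  unfolding subpower_def
proof (intro conjI allI impI)
  show "continuous_on {0<..} (\<lambda>x. x * f x)"
    by (intro continuous_intros subpower_continuous assms)
  fix q :: real assume "q > 0"
  then have q: "q + 1 > 0" by simp
  obtain C where C: "\<And>x. x > 0 \<Longrightarrow> \<bar>f x\<bar> \<le> C * x powr (- (q + 1))"
    using subpowerD[OF assms(1) q] by blast
  have "\<bar>x * f x\<bar> \<le> C * x powr (- q)" if "x > 0" for x
  proof -
    have "x powr (- q) = x * x powr (- (q + 1))"
      using that powr_add[of x 1 "- (q + 1)"] by simp
    then show ?thesis
      using mult_left_mono[OF C[OF that], of x] that by (simp add: abs_mult mult_ac)
  qed
  then show "\<exists>C. \<forall>x>0. \<bar>x * f x\<bar> \<le> C * x powr (- q)"
    by blast
qed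

lemma subpower_poly_mult:
  assumes "subpower f"
  shows "subpower (\<lambda>x. poly A x * f x)"
proof (induction A)
  case 0
  then show ?case
    using subpower_cmult[OF assms, of 0] by simp
next
  case (pCons a A)
  then show ?case
    using subpower_add[OF subpower_cmult[OF assms, of a] subpower_times_self[OF pCons.IH]]
    by (simp add: algebra_simps)
qed

text \<open>On \<open>{0<..1}\<close> the bound with \<open>q = s / 2\<close> leaves the integrable
  power \<open>s / 2 - 1\<close>; on \<open>{1..}\<close> the bound with \<open>q = s + 1\<close>
  leaves the power \<open>- 2\<close>.\<close>

lemma subpower_absolutely_integrable:
  assumes f: "subpower f" and s: "s > 0"
  shows "(\<lambda>x. f x * x powr (s - 1)) absolutely_integrable_on {0<..}"
proof -
  have cont: "continuous_on S (\<lambda>x. f x * x powr (s - 1))" if "S \<subseteq> {0<..}" for S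
    using that by (intro continuous_intros continuous_on_subset[OF subpower_continuous[OF f]]) auto
  have "s / 2 > 0" "s + 1 > 0" using s by auto
  obtain C where C: "\<And>x. x > 0 \<Longrightarrow> \<bar>f x\<bar> \<le> C * x powr (- (s / 2))"
    using subpowerD[OF f \<open>s / 2 > 0\<close>] by blast
  obtain D where D: "\<And>x. x > 0 \<Longrightarrow> \<bar>f x\<bar> \<le> D * x powr (- (s + 1))"
    using subpowerD[OF f \<open>s + 1 > 0\<close>] by blast
  have "(\<lambda>x. f x * x powr (s - 1)) absolutely_integrable_on {0<..1}"
  proof (rule absolutely_integrable_continuous_dominated)
    show "(\<lambda>x. C * x powr (s / 2 - 1)) integrable_on {0<..1}"
      using s by (intro integrable_on_mult_right integrable_on_powr_from_0') auto
    fix x :: real assume "x \<in> {0<..1}"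
    then have x: "x > 0" by simp
    have "\<bar>f x\<bar> * x powr (s - 1) \<le> C * x powr (- (s / 2)) * x powr (s - 1)"
      using C[OF x] by (intro mult_right_mono) auto
    then show "\<bar>f x * x powr (s - 1)\<bar> \<le> C * x powr (s / 2 - 1)"
      by (simp add: abs_mult mult.assoc flip: powr_add)
  qed (auto intro: cont)
  moreover have "(\<lambda>x. f x * x powr (s - 1)) absolutely_integrable_on {1..}"
  proof (rule absolutely_integrable_continuous_dominated)
    have "(\<lambda>x::real. x powr - 2) integrable_on {1..}"
      using has_integral_powr_to_inf[of "- 2" 1] by (auto simp: integrable_on_def)
    then show "(\<lambda>x. D * x powr - 2) integrable_on {1..}"
      by (rule integrable_on_mult_right)
    fix x :: real assume "x \<in> {1..}"
    then have x: "x > 0" by simp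
    have "\<bar>f x\<bar> * x powr (s - 1) \<le> D * x powr (- (s + 1)) * x powr (s - 1)"
      using D[OF x] by (intro mult_right_mono) auto
    then show "\<bar>f x * x powr (s - 1)\<bar> \<le> D * x powr - 2"
      by (simp add: abs_mult mult.assoc flip: powr_add)
  qed (auto intro: cont)
  ultimately have "(\<lambda>x. f x * x powr (s - 1)) absolutely_integrable_on ({0<..1} \<union> {1..})"
    by (rule absolutely_integrable_Un)
  also have "{0<..1} \<union> {1..} = {0::real<..}"
    by auto
  finally show ?thesis .
qed

text \<open>Supplies the vanishing boundary terms, with the same two exponents as for
  integrability.\<close>

lemma subpower_tendsto:
  assumes f: "subpower f" and s: "s > 0"
  shows "((\<lambda>x. x powr s * f x) \<longlongrightarrow> 0) (at_right 0)" "((\<lambda>x. x powr s * f x) \<longlongrightarrow> 0) at_top"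
proof -
  have "s / 2 > 0" "s + 1 > 0" using s by auto
  obtain C where C: "\<And>x. x > 0 \<Longrightarrow> \<bar>f x\<bar> \<le> C * x powr (- (s / 2))"
    using subpowerD[OF f \<open>s / 2 > 0\<close>] by blast
  obtain D where D: "\<And>x. x > 0 \<Longrightarrow> \<bar>f x\<bar> \<le> D * x powr (- (s + 1))"
    using subpowerD[OF f \<open>s + 1 > 0\<close>] by blast
  have C': "norm (x powr s * f x) \<le> C * x powr (s / 2)" if "x > 0" for x
    using mult_left_mono[OF C[OF that], of "x powr s"]
    by (simp add: abs_mult mult.left_commute flip: powr_add)
  have D': "norm (x powr s * f x) \<le> D * x powr - 1" if "x > 0" for x
    using mult_left_mono[OF D[OF that], of "x powr s"]
    by (simp add: abs_mult mult.left_commute flip: powr_add)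
  show "((\<lambda>x. x powr s * f x) \<longlongrightarrow> 0) (at_right 0)"
  proof (rule Lim_null_comparison)
    show "\<forall>\<^sub>F x in at_right 0. norm (x powr s * f x) \<le> C * x powr (s / 2)"
      using eventually_at_right_less[of 0] by eventually_elim (rule C')
    have "((\<lambda>x. x powr (s / 2)) \<longlongrightarrow> 0 powr (s / 2)) (at_right 0)"
      using s by (intro tendsto_powr') (auto simp: eventually_at_right_less less_imp_le
          intro!: eventually_mono[OF eventually_at_right_less[of 0]])
    from tendsto_mult_left[OF this, of C] show "((\<lambda>x. C * x powr (s / 2)) \<longlongrightarrow> 0) (at_right 0)"
      by simp
  qed
  show "((\<lambda>x. x powr s * f x) \<longlongrightarrow> 0) at_top"
  proof (rule Lim_null_comparison)
    show "\<forall>\<^sub>F x in at_top. norm (x powr s * f x) \<le> D * x powr - 1"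
      using eventually_gt_at_top[of 0] by eventually_elim (rule D')
    have "((\<lambda>x::real. x powr - 1) \<longlongrightarrow> 0) at_top"
      by (intro tendsto_neg_powr filterlim_ident) simp
    from tendsto_mult_left[OF this, of D] show "((\<lambda>x. D * x powr - 1) \<longlongrightarrow> 0) at_top"
      by simp
  qed
qed

lemma subpower_rho:
  assumes "\<mu> \<ge> 0"
  shows "subpower (rho \<mu>)"
  unfolding subpower_def
proof (intro conjI allI impI)
  show "continuous_on {0<..} (rho \<mu>)"
    by (intro continuous_at_imp_continuous_on ballI DERIV_isCont[OF has_real_derivative_rho]) auto
  fix q :: real assume q: "q > 0"
  \<comment> \<open>Chosen so that \<open>x powr (\<mu> / 2)\<close> times the power
    \<open>- p / 2\<close> of \<open>x\<close> from the Macdonald bound is exactly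
    \<open>x powr (- q)\<close>.\<close>
  define p where "p = \<mu> + 2 * q"
  have p: "p > 0" using assms q by (simp add: p_def)
  have "\<bar>rho \<mu> x\<bar> \<le> p powr p / q * x powr (- q)" if "x > 0" for x
  proof -
    have "macdonald_K \<mu> (2 * sqrt x) \<le> (p / sqrt x) powr p / (p - \<bar>\<mu>\<bar>)"
      using macdonald_K_upper[of "2 * sqrt x" \<mu> p] that assms q
      unfolding mult_divide_mult_cancel_left[OF numeral_neq_zero] by (simp add: p_def)
    also have "p / sqrt x = p * x powr (- 1 / 2)"
      using that by (simp add: powr_minus_divide powr_half_sqrt)
    also have "\<dots> powr p = p powr p * x powr (- p / 2)"
      using p by (simp add: powr_mult powr_powr)
    also have "p - \<bar>\<mu>\<bar> = 2 * q"
      using assms by (simp add: p_def)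
    finally have "rho \<mu> x \<le> 2 * x powr (\<mu> / 2) * (p powr p * x powr (- p / 2) / (2 * q))"
      unfolding rho_def by (intro mult_left_mono) auto
    also have "\<dots> = p powr p / q * (x powr (\<mu> / 2) * x powr (- p / 2))"
      using q by simp
    also have "x powr (\<mu> / 2) * x powr (- p / 2) = x powr (- q)"
      by (simp add: p_def field_simps flip: powr_add)
    finally show ?thesis
      using rho_pos[OF that, of \<mu>] by simp
  qed
  then show "\<exists>C. \<forall>x>0. \<bar>rho \<mu> x\<bar> \<le> C * x powr (- q)"
    by blast
qed

lemma subpower_type1_fun:
  assumes "\<nu> \<ge> 0"
  shows "subpower (type1_fun \<nu> A B C)"
proof -
  have "subpower (rho \<nu>)" "subpower (rho (\<nu> + 1))"
    using assms by (auto intro: subpower_rho)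
  note this[THEN subpower_mult]
  then show ?thesis
    unfolding type1_fun_def[abs_def] power2_eq_square mult.assoc[of _ "rho \<nu> _"]
    by (intro subpower_add subpower_poly_mult) (simp_all add: \<open>subpower (rho (\<nu> + 1))\<close> \<open>subpower (rho \<nu>)\<close>)
qed

subsection \<open>Mellin transforms of type 1 functions\<close>

text \<open>\<open>recA\<close>, \<open>recB\<close>, \<open>recC\<close> are the right-hand sides
  of the three differential recurrences with \<open>\<alpha>\<close> replaced by a free
  \<open>s\<close>, which is later either \<open>\<alpha>\<close> or the Mellin variable.\<close>

definition recA :: "real \<Rightarrow> real \<Rightarrow> real poly \<Rightarrow> real poly \<Rightarrow> real poly" where
  "recA \<nu> s A C = smult (s + 2 * \<nu>) A + pCons 0 (pderiv A) - pCons 0 C"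

definition recB :: "real \<Rightarrow> real poly \<Rightarrow> real poly \<Rightarrow> real poly" where
  "recB s B C = smult s B + pCons 0 (pderiv B) - C"

definition recC :: "real \<Rightarrow> real \<Rightarrow> real poly \<Rightarrow> real poly \<Rightarrow> real poly \<Rightarrow> real poly" where
  "recC \<nu> s A B C = smult (s + \<nu>) C + pCons 0 (pderiv C) - smult 2 A - smult 2 (pCons 0 B)"

text \<open>Product rule: the only denominator, the \<open>1 / x\<close> in the derivative of
  \<open>rho \<nu>\<close>, is absorbed by \<open>x powr s = x * x powr (s - 1)\<close>.\<close>

lemma has_real_derivative_type1_fun:
  assumes x: "x > 0"
  shows "((\<lambda>y. y powr s * type1_fun \<nu> A B C y) has_real_derivative
    x powr (s - 1) * type1_fun \<nu> (recA \<nu> s A C) (recB s B C) (recC \<nu> s A B C) x) (at x)"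
proof -
  define u where "u = rho \<nu> x"
  define v where "v = rho (\<nu> + 1) x"
  have P: "x powr s = x * x powr (s - 1)"
    using x by (simp add: powr_diff)
  have d1: "((\<lambda>y. y powr s) has_real_derivative s * x powr (s - 1)) (at x)"
    using x by (rule has_real_derivative_powr)
  have product_rule: "((\<lambda>y. poly A y * (f y)\<^sup>2 + poly B y * (g y)\<^sup>2 + poly C y * f y * g y) has_real_derivative
      poly (pderiv A) x * (f x)\<^sup>2 + poly A x * (2 * f x * f')
      + (poly (pderiv B) x * (g x)\<^sup>2 + poly B x * (2 * g x * g'))
      + (poly (pderiv C) x * (f x * g x) + poly C x * (f' * g x + f x * g'))) (at x)"
    if "(f has_real_derivative f') (at x)" "(g has_real_derivative g') (at x)" for f g f' g'
    by (auto intro!: derivative_eq_intros that poly_DERIV simp: algebra_simps)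
  have d2: "(type1_fun \<nu> A B C has_real_derivative
      poly (pderiv A) x * u\<^sup>2 + poly A x * (2 * u * ((\<nu> * u - v) / x))
      + (poly (pderiv B) x * v\<^sup>2 + poly B x * (2 * v * (- u)))
      + (poly (pderiv C) x * (u * v) + poly C x * (((\<nu> * u - v) / x) * v + u * (- u)))) (at x)"
    unfolding type1_fun_def[abs_def] u_def v_def
    by (rule product_rule[OF has_real_derivative_rho[OF x] has_real_derivative_rho_Suc[OF x]])
  show ?thesis
  proof (rule DERIV_cong[OF DERIV_mult[OF d1 d2]])
    have factor: "s * X * t + d * (x * X) = X * (s * t + r)" if "x * d = r" for X t d r
      using that[symmetric] by (simp add: algebra_simps)
    \<comment> \<open>\<open>w\<close> is the derivative of \<open>rho \<nu>\<close>; after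
      multiplication by \<open>x\<close> it is linear in \<open>u\<close> and \<open>v\<close>, so
      no division remains.\<close>
    define w where "w = (\<nu> * u - v) / x"
    have w: "x * w = \<nu> * u - v"
      using x by (simp add: w_def)
    have "x * (poly (pderiv A) x * u\<^sup>2 + poly A x * (2 * u * w)
        + (poly (pderiv B) x * v\<^sup>2 + poly B x * (2 * v * (- u)))
        + (poly (pderiv C) x * (u * v) + poly C x * (w * v + u * (- u))))
      = x * poly (pderiv A) x * u\<^sup>2 + poly A x * (2 * u * (x * w))
        + (x * poly (pderiv B) x * v\<^sup>2 + x * poly B x * (2 * v * (- u)))
        + (x * poly (pderiv C) x * (u * v) + poly C x * ((x * w) * v + x * u * (- u)))"
      by (simp add: algebra_simps)
    also have "\<dots> = type1_fun \<nu> (recA \<nu> s A C) (recB s B C) (recC \<nu> s A B C) x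
        - s * type1_fun \<nu> A B C x"
      unfolding w type1_fun_def u_def[symmetric] v_def[symmetric]
      by (simp add: recA_def recB_def recC_def power2_eq_square algebra_simps)
    finally have "x * (poly (pderiv A) x * u\<^sup>2 + poly A x * (2 * u * w)
        + (poly (pderiv B) x * v\<^sup>2 + poly B x * (2 * v * (- u)))
        + (poly (pderiv C) x * (u * v) + poly C x * (w * v + u * (- u))))
      = type1_fun \<nu> (recA \<nu> s A C) (recB s B C) (recC \<nu> s A B C) x
        - s * type1_fun \<nu> A B C x" (is "x * ?d = ?r") .
    then have "s * x powr (s - 1) * type1_fun \<nu> A B C x + ?d * x powr s
        = x powr (s - 1) * (s * type1_fun \<nu> A B C x + ?r)"
      unfolding P by (rule factor)
    then show "s * x powr (s - 1) * type1_fun \<nu> A B C x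
        + (poly (pderiv A) x * u\<^sup>2 + poly A x * (2 * u * ((\<nu> * u - v) / x))
          + (poly (pderiv B) x * v\<^sup>2 + poly B x * (2 * v * (- u)))
          + (poly (pderiv C) x * (u * v) + poly C x * (((\<nu> * u - v) / x) * v + u * (- u)))) * x powr s
      = x powr (s - 1) * type1_fun \<nu> (recA \<nu> s A C) (recB s B C) (recC \<nu> s A B C) x"
      unfolding w_def by simp
  qed
qed

text \<open>With the usual exponent \<open>s - 1\<close>, the orthogonality condition for
  \<open>x powr (\<alpha> + m)\<close> is a zero at \<open>s = \<alpha> + m + 1\<close>.\<close>

definition mellin1 :: "real \<Rightarrow> real poly \<Rightarrow> real poly \<Rightarrow> real poly \<Rightarrow> real \<Rightarrow> real" where
  "mellin1 \<nu> A B C s = integral {0<..} (\<lambda>x. type1_fun \<nu> A B C x * x powr (s - 1))"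

lemma has_integral_mellin1:
  assumes "\<nu> \<ge> 0" "s > 0"
  shows "((\<lambda>x. type1_fun \<nu> A B C x * x powr (s - 1)) has_integral mellin1 \<nu> A B C s) {0<..}"
  using subpower_absolutely_integrable[OF subpower_type1_fun[OF assms(1)] assms(2)]
  unfolding mellin1_def absolutely_integrable_on_def by (blast intro: integrable_integral)

lemma mellin1_eqI:
  assumes "((\<lambda>x. type1_fun \<nu> A B C x * x powr (s - 1)) has_integral i) {0<..}"
  shows "mellin1 \<nu> A B C s = i"
  using assms unfolding mellin1_def by (rule integral_unique)

lemma mellin1_add:
  assumes "\<nu> \<ge> 0" "s > 0"
  shows "mellin1 \<nu> (A + A') (B + B') (C + C') s = mellin1 \<nu> A B C s + mellin1 \<nu> A' B' C' s"
proof (rule mellin1_eqI)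
  show "((\<lambda>x. type1_fun \<nu> (A + A') (B + B') (C + C') x * x powr (s - 1))
      has_integral mellin1 \<nu> A B C s + mellin1 \<nu> A' B' C' s) {0<..}"
    using has_integral_add[OF has_integral_mellin1[OF assms, of A B C]
        has_integral_mellin1[OF assms, of A' B' C']]
    by (rule has_integral_eq[rotated]) (simp add: type1_fun_def algebra_simps)
qed

lemma mellin1_smult:
  assumes "\<nu> \<ge> 0" "s > 0"
  shows "mellin1 \<nu> (smult c A) (smult c B) (smult c C) s = c * mellin1 \<nu> A B C s"
proof (rule mellin1_eqI)
  show "((\<lambda>x. type1_fun \<nu> (smult c A) (smult c B) (smult c C) x * x powr (s - 1))
      has_integral c * mellin1 \<nu> A B C s) {0<..}"
    using has_integral_mult_right[OF has_integral_mellin1[OF assms, of A B C], of c]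
    by (rule has_integral_eq[rotated]) (simp add: type1_fun_def algebra_simps)
qed

lemma mellin1_diff:
  assumes "\<nu> \<ge> 0" "s > 0"
  shows "mellin1 \<nu> (A - A') (B - B') (C - C') s = mellin1 \<nu> A B C s - mellin1 \<nu> A' B' C' s"
  using mellin1_add[OF assms, of A "smult (- 1) A'" B "smult (- 1) B'" C "smult (- 1) C'"]
    mellin1_smult[OF assms, of "- 1" A' B' C'] by simp

lemma mellin1_shift:
  assumes "\<nu> \<ge> 0" "s > 0"
  shows "mellin1 \<nu> (pCons 0 A) (pCons 0 B) (pCons 0 C) s = mellin1 \<nu> A B C (s + 1)"
proof (rule mellin1_eqI)
  have eq: "x powr s = x * x powr (s - 1)" if "x > 0" for x :: real
    using that by (simp add: powr_diff)
  have "s + 1 > 0" using assms by simp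
  from has_integral_mellin1[OF assms(1) this, of A B C]
  show "((\<lambda>x. type1_fun \<nu> (pCons 0 A) (pCons 0 B) (pCons 0 C) x * x powr (s - 1))
      has_integral mellin1 \<nu> A B C (s + 1)) {0<..}"
    by (rule has_integral_eq[rotated]) (simp add: type1_fun_def eq algebra_simps)
qed

text \<open>The integrand is the derivative of \<open>x powr s * type1_fun \<nu> A B C x\<close>,
  which tends to 0 at both ends.\<close>

lemma mellin1_rec_zero:
  assumes "\<nu> \<ge> 0" "s > 0"
  shows "mellin1 \<nu> (recA \<nu> s A C) (recB s B C) (recC \<nu> s A B C) s = 0"
proof (rule mellin1_eqI)
  let ?g = "type1_fun \<nu> (recA \<nu> s A C) (recB s B C) (recC \<nu> s A B C)"
  have "((\<lambda>x. ?g x * x powr (s - 1)) has_integral 0 - 0) {0<..}"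
  proof (rule has_integral_FTC_Ioi)
    show "((\<lambda>y. y powr s * type1_fun \<nu> A B C y) has_real_derivative ?g x * x powr (s - 1)) (at x)"
      if "x > 0" for x
      using has_real_derivative_type1_fun[OF that] by (simp add: mult.commute)
    show "continuous_on {0<..} (\<lambda>x. ?g x * x powr (s - 1))"
      by (intro continuous_intros subpower_continuous subpower_type1_fun assms) auto
    show "(\<lambda>x. ?g x * x powr (s - 1)) absolutely_integrable_on {0<..}"
      by (intro subpower_absolutely_integrable subpower_type1_fun assms)
  qed (intro subpower_tendsto subpower_type1_fun assms)+
  then show "((\<lambda>x. ?g x * x powr (s - 1)) has_integral 0) {0<..}"
    by simp
qed

text \<open>The parameter enters the three operators only through a multiple of the identity.
  Replacing \<open>\<alpha>\<close> by \<open>s\<close> therefore splits off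
  \<open>\<alpha> - s\<close> times the original triple and leaves a triple with zero
  transform.\<close>

lemma mellin1_rec:
  assumes "\<nu> \<ge> 0" "s > 0"
  shows "mellin1 \<nu> (recA \<nu> \<alpha> A C) (recB \<alpha> B C) (recC \<nu> \<alpha> A B C) s
    = (\<alpha> - s) * mellin1 \<nu> A B C s"
proof -
  have "recA \<nu> \<alpha> A C = smult (\<alpha> - s) A + recA \<nu> s A C"
    "recB \<alpha> B C = smult (\<alpha> - s) B + recB s B C"
    "recC \<nu> \<alpha> A B C = smult (\<alpha> - s) C + recC \<nu> s A B C"
    unfolding recA_def recB_def recC_def
    by (simp_all add: smult_diff_left smult_add_left)
  then show ?thesis
    using mellin1_add[OF assms, of "smult (\<alpha> - s) A" "recA \<nu> s A C" "smult (\<alpha> - s) B" "recB s B C"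
        "smult (\<alpha> - s) C" "recC \<nu> s A B C"]
      mellin1_smult[OF assms, of "\<alpha> - s" A B C] mellin1_rec_zero[OF assms, of A C B]
    by simp
qed

lemma mellin1_pos:
  assumes "\<nu> \<ge> 0" "s > 0"
  shows "mellin1 \<nu> 1 0 0 s > 0"
proof -
  define g where "g = (\<lambda>x. (rho \<nu> x)\<^sup>2 * x powr (s - 1))"
  have g: "(g has_integral mellin1 \<nu> 1 0 0 s) {0<..}"
    using has_integral_mellin1[OF assms, of 1 0 0] by (simp add: type1_fun_def g_def)
  have gpos: "g x > 0" if "x > 0" for x
    using rho_pos[OF that, of \<nu>] that by (simp add: g_def)
  have cont: "continuous_on {1..2} g"
    unfolding g_def using assms
    by (intro continuous_intros continuous_on_subset[OF subpower_continuous[OF subpower_rho]]) auto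
  then obtain m where m: "m \<in> {1..2}" "\<And>x. x \<in> {1..2} \<Longrightarrow> g m \<le> g x"
    using continuous_attains_inf[of "{1..2}" g] by auto
  have "((\<lambda>x. g m) has_integral g m) {1..2::real}"
    using has_integral_const_real[of "g m" 1 2] by simp
  then have "g m \<le> integral {1..2} g"
    using m(2) by (intro has_integral_le[OF _ integrable_integral] integrable_continuous_interval cont)
  also have "\<dots> \<le> integral {0<..} g"
    using g gpos by (intro integral_subset_le integrable_continuous_interval cont)
      (auto simp: integrable_on_def less_imp_le)
  also have "\<dots> = mellin1 \<nu> 1 0 0 s"
    using g by (rule integral_unique)
  finally show ?thesis
    using gpos[of m] m(1) by simp
qed

lemma mellin1_const:
  assumes "\<nu> \<ge> 0" "s > 0"
  shows "mellin1 \<nu> [:a:] [:b:] [:c:] s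
    = a * mellin1 \<nu> 1 0 0 s + b * mellin1 \<nu> 0 1 0 s + c * mellin1 \<nu> 0 0 1 s"
  using mellin1_add[OF assms, of "[:a:]" 0 0 "[:b:]" 0 "[:c:]"]
    mellin1_add[OF assms, of 0 0 "[:b:]" 0 0 "[:c:]"]
    mellin1_smult[OF assms, of a 1 0 0] mellin1_smult[OF assms, of b 0 1 0]
    mellin1_smult[OF assms, of c 0 0 1]
  by (simp add: one_pCons)

text \<open>\<open>mellin1_rec_zero\<close> for the three unit triples gives linear relations
  between \<open>?a\<close>, \<open>?b\<close>, \<open>?c\<close> at \<open>s\<close> and
  \<open>s + 1\<close>; solving them expresses all through \<open>?a s\<close>.\<close>

lemma mellin1_base:
  assumes "\<nu> \<ge> 0" "s > 0"
  shows mellin1_C: "mellin1 \<nu> 0 0 1 s = (s + 2 * \<nu>) / 2 * mellin1 \<nu> 1 0 0 s"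
    and mellin1_B: "mellin1 \<nu> 0 1 0 s
      = (s + 2 * \<nu>) * (s + 2 * \<nu> + 1) * (s + \<nu>) / (4 * (s + \<nu> + 1 / 2)) * mellin1 \<nu> 1 0 0 s"
    and mellin1_A_Suc: "mellin1 \<nu> 1 0 0 (s + 1)
      = s * (s + \<nu>) * (s + 2 * \<nu>) / (4 * (s + \<nu> + 1 / 2)) * mellin1 \<nu> 1 0 0 s"
proof -
  have s1: "s + 1 > 0" using assms by simp
  let ?a = "mellin1 \<nu> 1 0 0" and ?b = "mellin1 \<nu> 0 1 0" and ?c = "mellin1 \<nu> 0 0 1"
  have C: "?c s = (s + 2 * \<nu>) / 2 * ?a s" if "s > 0" for s
  proof -
    have "(s + 2 * \<nu>) * ?a s - 2 * ?c s = 0"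
      using mellin1_rec_zero[OF assms(1) that, of 1 0 0] mellin1_const[OF assms(1) that, of "s + 2 * \<nu>" 0 "- 2"]
      by (simp add: recA_def recB_def recC_def one_pCons pderiv_pCons)
    then show ?thesis by simp
  qed
  \<comment> \<open>The triple with only \<open>B = 1\<close>; the instantiation order is
    \<open>A\<close>, \<open>C\<close>, \<open>B\<close>.\<close>
  have "s * ?b s - 2 * ?c (s + 1) = 0"
    using mellin1_rec_zero[OF assms, of 0 0 1] mellin1_const[OF assms, of 0 s 0]
      mellin1_add[OF assms, of 0 0 "[:s:]" 0 0 "pCons 0 [:-2:]"]
      mellin1_shift[OF assms, of 0 0 "[:-2:]"] mellin1_const[OF assms(1) s1, of 0 0 "-2"]
    by (simp add: recA_def recB_def recC_def one_pCons pderiv_pCons)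
  then have B: "s * ?b s = (s + 1 + 2 * \<nu>) * ?a (s + 1)"
    using C[OF s1] by simp
  \<comment> \<open>The triple with only \<open>C = 1\<close>.\<close>
  have "(s + \<nu>) * ?c s - ?b s - ?a (s + 1) = 0"
    using mellin1_rec_zero[OF assms, of 0 1 0] mellin1_const[OF assms, of 0 "- 1" "s + \<nu>"]
      mellin1_add[OF assms, of "pCons 0 [:-1:]" 0 0 "[:- 1:]" 0 "[:s + \<nu>:]"]
      mellin1_shift[OF assms, of "[:-1:]" 0 0] mellin1_const[OF assms(1) s1, of "-1" 0 0]
    by (simp add: recA_def recB_def recC_def one_pCons pderiv_pCons)
  then have R: "?b s + ?a (s + 1) = (s + \<nu>) * ((s + 2 * \<nu>) / 2 * ?a s)"
    using C[OF assms(2)] by simp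
  \<comment> \<open>Eliminating \<open>?b s\<close> leaves one equation for
    \<open>?a (s + 1)\<close>.\<close>
  have "s * (?b s + ?a (s + 1)) = (2 * s + 2 * \<nu> + 1) * ?a (s + 1)"
    using B by (simp add: algebra_simps)
  then have "(2 * s + 2 * \<nu> + 1) * ?a (s + 1) = s * ((s + \<nu>) * ((s + 2 * \<nu>) / 2 * ?a s))"
    unfolding R by simp
  moreover have nz: "4 * (s + \<nu> + 1 / 2) \<noteq> 0" "s \<noteq> 0"
    using assms by auto
  ultimately show A: "?a (s + 1) = s * (s + \<nu>) * (s + 2 * \<nu>) / (4 * (s + \<nu> + 1 / 2)) * ?a s"
    by (simp add: eq_divide_eq algebra_simps)
  show "?c s = (s + 2 * \<nu>) / 2 * ?a s"
    by (rule C[OF assms(2)])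
  have "s * ?b s = s * ((s + 2 * \<nu>) * (s + 2 * \<nu> + 1) * (s + \<nu>) / (4 * (s + \<nu> + 1 / 2)) * ?a s)"
    unfolding B A by (simp add: mult_ac)
  then show "?b s = (s + 2 * \<nu>) * (s + 2 * \<nu> + 1) * (s + \<nu>) / (4 * (s + \<nu> + 1 / 2)) * ?a s"
    using nz(2) mult_left_cancel by blast
qed

subsection \<open>The polynomial determining a Mellin transform\<close>

text \<open>The rising factorial of \<open>s + \<nu> + 1 / 2\<close> with \<open>n\<close> factors:
  the denominator accumulated by \<open>n\<close> unit shifts. The first factor is split off because
  the induction below removes constant terms and passes to \<open>s + 1\<close>.\<close>

primrec mellin_denom :: "real \<Rightarrow> nat \<Rightarrow> real poly" where
  "mellin_denom \<nu> 0 = 1"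
| "mellin_denom \<nu> (Suc n) = [:\<nu> + 1 / 2, 1:] * pcompose (mellin_denom \<nu> n) [:1, 1:]"

lemma poly_mellin_denom_Suc:
  "poly (mellin_denom \<nu> (Suc n)) s = (s + \<nu> + 1 / 2) * poly (mellin_denom \<nu> n) (s + 1)"
proof -
  have "\<nu> + 1 / 2 + s = s + \<nu> + 1 / 2"
    by simp
  then show ?thesis
    by (simp only: mellin_denom.simps poly_mult poly_pcompose poly_pCons poly_0)
      (simp add: add_ac)
qed

lemma degree_mellin_denom: "degree (mellin_denom \<nu> n) \<le> n"
proof (induction n)
  case (Suc n)
  have "degree (mellin_denom \<nu> (Suc n))
      \<le> degree [:\<nu> + 1 / 2, 1:] + degree (pcompose (mellin_denom \<nu> n) [:1, 1:])"
    unfolding mellin_denom.simps by (rule degree_mult_le)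
  then show ?case
    using Suc by (simp add: degree_pcompose)
qed simp

text \<open>The range reaches below 0 and, when \<open>\<nu> < 1 / 2\<close>, includes the
  evaluation points \<open>- 2 * \<nu>\<close> and \<open>- \<nu>\<close>.\<close>

lemma mellin_denom_pos: "s + \<nu> + 1 / 2 > 0 \<Longrightarrow> poly (mellin_denom \<nu> n) s > 0"
proof (induction n arbitrary: s)
  case (Suc n)
  have "poly (mellin_denom \<nu> n) (s + 1) > 0"
    using Suc.prems by (intro Suc.IH) simp
  with Suc.prems show ?case
    unfolding poly_mellin_denom_Suc by (rule mult_pos_pos)
qed simp

text \<open>Splitting off the constant terms of \<open>A\<close>, \<open>B\<close>, \<open>C\<close>
  leaves \<open>x\<close> times a smaller triple, whose transform is taken at \<open>s + 1\<close>;
  \<open>mellin1_A_Suc\<close> brings it back to \<open>s\<close> and raises the degree by 3. The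
  \<open>3 * n + 2\<close> coefficients of the triple match those of \<open>P\<close>. The
  disjunction on \<open>B\<close> forces \<open>B = 0\<close> for \<open>n = 0\<close>.\<close>

lemma mellin1_eq_polynomial:
  assumes \<nu>: "0 \<le> \<nu>" "\<nu> < 1 / 2"
    and "degree A \<le> n" "degree C \<le> n" "B = 0 \<or> degree B < n"
  shows "\<exists>P. degree P \<le> 3 * n + 1 \<and>
    (\<forall>s>0. mellin1 \<nu> A B C s * poly (mellin_denom \<nu> n) s = mellin1 \<nu> 1 0 0 s * poly P s) \<and>
    (P = 0 \<longrightarrow> A = 0 \<and> B = 0 \<and> C = 0)"
  using assms(3-)
proof (induction n arbitrary: A B C)
  case 0
  then obtain a c where AC: "A = [:a:]" "C = [:c:]" and B: "B = 0"
    by (auto elim!: degree_eq_zeroE)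
  \<comment> \<open>This is \<open>a + c * (s + 2 * \<nu>) / 2\<close>, by
    \<open>mellin1_C\<close>.\<close>
  define P where "P = [:a + c * \<nu>, c / 2:]"
  have "mellin1 \<nu> A B C s = mellin1 \<nu> 1 0 0 s * poly P s" if "s > 0" for s
    using mellin1_const[OF \<nu>(1) that, of a 0 c] mellin1_C[OF \<nu>(1) that]
    by (simp add: AC B P_def algebra_simps)
  moreover have "degree P \<le> 1"
    by (simp add: P_def)
  ultimately show ?case
    by (intro exI[of _ P]) (auto simp: P_def AC B)
next
  case (Suc n)
  obtain a A' where A: "A = pCons a A'" by (cases A)
  obtain b B' where B: "B = pCons b B'" by (cases B)
  obtain c C' where C: "C = pCons c C'" by (cases C)
  have "degree A' \<le> n" "degree C' \<le> n" "B' = 0 \<or> degree B' < n"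
    using Suc.prems by (auto simp: A B C split: if_splits)
  from Suc.IH[OF this] obtain P where P: "degree P \<le> 3 * n + 1"
    "\<And>s. s > 0 \<Longrightarrow> mellin1 \<nu> A' B' C' s * poly (mellin_denom \<nu> n) s = mellin1 \<nu> 1 0 0 s * poly P s"
    "P = 0 \<Longrightarrow> A' = 0 \<and> B' = 0 \<and> C' = 0"
    by blast
  define D where "D = mellin_denom \<nu> (Suc n)"
  define E where "E = pcompose (mellin_denom \<nu> n) [:1, 1:]"
  define R where "R = pcompose P [:1, 1:]"
  \<comment> \<open>\<open>E\<close> and \<open>R\<close> are the previous denominator and
    polynomial at \<open>s + 1\<close>. The nesting of \<open>Q\<close> and \<open>Q1\<close> by the
    factors \<open>s + 2 * \<nu>\<close>, \<open>s + \<nu>\<close> and \<open>s\<close> lets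
    \<open>a\<close>, \<open>c\<close> and \<open>b\<close> be read off one at a time.\<close>
  define Q1 where "Q1 = [:c / 2:] * D + [:\<nu>, 1:] * ([:b / 4:] * [:2 * \<nu> + 1, 1:] * E + [:0, 1 / 4:] * R)"
  define Q where "Q = [:a:] * D + [:2 * \<nu>, 1:] * Q1"
  have degD: "degree D \<le> Suc n"
    unfolding D_def by (rule degree_mellin_denom)
  have degE: "degree E \<le> n" and degR: "degree R \<le> 3 * n + 1"
    using degree_mellin_denom[of \<nu> n] P(1) by (simp_all add: E_def R_def degree_pcompose)
  have deg_mult: "degree (p * q) \<le> k + l" if "degree p \<le> k" "degree q \<le> l" for p q :: "real poly" and k l
    using degree_mult_le[of p q] that by linarith
  have degs: "degree [:x:] \<le> 0" "degree [:x, y:] \<le> 1" for x y :: real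
    by simp_all
  have "degree ([:b / 4:] * [:2 * \<nu> + 1, 1:] * E) \<le> 3 * n + 2"
    using deg_mult[OF deg_mult[OF degs(1) degs(2)] degE, of "b / 4" "2 * \<nu> + 1" 1] by linarith
  moreover have "degree ([:0, 1 / 4:] * R) \<le> 3 * n + 2"
    using deg_mult[OF degs(2) degR, of 0 "1 / 4"] by linarith
  ultimately have "degree ([:\<nu>, 1:] * ([:b / 4:] * [:2 * \<nu> + 1, 1:] * E + [:0, 1 / 4:] * R)) \<le> 3 * n + 3"
    using deg_mult[OF degs(2) degree_add_le, of _ "3 * n + 2" _ \<nu> 1] by fastforce
  moreover have "degree ([:c / 2:] * D) \<le> 3 * n + 3"
    using deg_mult[OF degs(1) degD, of "c / 2"] by linarith
  ultimately have "degree Q1 \<le> 3 * n + 3"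
    unfolding Q1_def by (intro degree_add_le)
  from deg_mult[OF degs(2) this] have "degree ([:2 * \<nu>, 1:] * Q1) \<le> 3 * Suc n + 1"
    by (rule order_trans) simp
  moreover from deg_mult[OF degs(1) degD] have "degree ([:a:] * D) \<le> 3 * Suc n + 1"
    by (rule order_trans) simp
  ultimately have "degree Q \<le> 3 * Suc n + 1"
    unfolding Q_def by (intro degree_add_le)
  moreover have "mellin1 \<nu> A B C s * poly D s = mellin1 \<nu> 1 0 0 s * poly Q s" if s: "s > 0" for s
  proof -
    let ?m = "mellin1 \<nu> 1 0 0" and ?e = "poly E s" and ?h = "s + \<nu> + 1 / 2"
    \<comment> \<open>The substitution of \<open>mellin1_base\<close> with every compound term made
      a variable, so that \<open>h\<close> is the only denominator to clear.\<close>
    have clear_denom: "h * ((a * m + b * (X / (4 * h) * m) + c * (Y / 2 * m)) * e + Z / (4 * h) * m * r)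
        = m * ((a + c * Y / 2) * (h * e) + X / 4 * b * e + Z / 4 * r)" if "h \<noteq> 0" for h m e r X Y Z
      using that by (simp add: field_simps)
    have h: "?h \<noteq> 0" using s \<nu> by simp
    have E: "?e = poly (mellin_denom \<nu> n) (s + 1)" and R: "poly R s = poly P (s + 1)"
      by (simp_all add: E_def R_def poly_pcompose add_ac)
    have D: "poly D s = ?h * ?e"
      unfolding D_def E by (rule poly_mellin_denom_Suc)
    have "mellin1 \<nu> A B C s = mellin1 \<nu> [:a:] [:b:] [:c:] s + mellin1 \<nu> A' B' C' (s + 1)"
      using mellin1_add[OF \<nu>(1) s, of "[:a:]" "pCons 0 A'" "[:b:]" "pCons 0 B'" "[:c:]" "pCons 0 C'"]
        mellin1_shift[OF \<nu>(1) s, of A' B' C']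
      by (simp add: A B C)
    then have "mellin1 \<nu> A B C s * poly D s
        = ?h * (mellin1 \<nu> [:a:] [:b:] [:c:] s * ?e + mellin1 \<nu> A' B' C' (s + 1) * ?e)"
      unfolding D by (simp add: distrib_left distrib_right mult_ac)
    also have "mellin1 \<nu> A' B' C' (s + 1) * ?e = ?m (s + 1) * poly R s"
      unfolding E R using s by (intro P(2)) simp
    also have "?h * (mellin1 \<nu> [:a:] [:b:] [:c:] s * ?e + ?m (s + 1) * poly R s)
        = ?m s * ((a + c * (s + 2 * \<nu>) / 2) * (?h * ?e)
          + ((s + 2 * \<nu>) * (s + 2 * \<nu> + 1) * (s + \<nu>) / 4) * b * ?e
          + (s * (s + \<nu>) * (s + 2 * \<nu>) / 4) * poly R s)"
      unfolding mellin1_const[OF \<nu>(1) s] mellin1_base[OF \<nu>(1) s] using h by (rule clear_denom)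
    also have "\<dots> = ?m s * poly Q s"
      unfolding Q_def Q1_def by (simp add: D algebra_simps add_divide_distrib)
    finally show ?thesis .
  qed
  moreover have "A = 0 \<and> B = 0 \<and> C = 0" if "Q = 0"
  proof -
    have "poly D (- 2 * \<nu>) > 0" "poly D (- \<nu>) > 0"
      unfolding D_def by (rule mellin_denom_pos, use \<nu> in simp)+
    have "poly E 0 > 0"
      unfolding E_def poly_pcompose using \<nu> by (auto intro!: mellin_denom_pos)
    \<comment> \<open>Here only \<open>a * D\<close> survives. Each linear factor is cancelled
      before the next evaluation, so the coincidence of the three points for
      \<open>\<nu> = 0\<close> is harmless.\<close>
    have "poly Q (- 2 * \<nu>) = 0"
      using that by simp
    then have a: "a = 0"
      using \<open>poly D (- 2 * \<nu>) > 0\<close> by (simp add: Q_def)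
    then have "Q1 = 0"
      using that unfolding Q_def a
      by (simp only: div_0 pCons_0_0 mult_zero_left add_0 mult_eq_0_iff) simp
    then have "poly Q1 (- \<nu>) = 0"
      by simp
    then have c: "c = 0"
      using \<open>poly D (- \<nu>) > 0\<close> by (simp add: Q1_def)
    then have Q2: "[:b / 4:] * [:2 * \<nu> + 1, 1:] * E + [:0, 1 / 4:] * R = 0" (is "?Q2 = 0")
      using \<open>Q1 = 0\<close> unfolding Q1_def c
      by (simp only: div_0 pCons_0_0 mult_zero_left add_0 mult_eq_0_iff) simp
    \<comment> \<open>At 0 the term with \<open>R\<close> drops out, leaving \<open>b\<close> times
      a positive number.\<close>
    then have "poly ?Q2 0 = 0"
      by (simp only: poly_0)
    then have b: "b = 0"
      using \<open>poly E 0 > 0\<close> \<nu> by simp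
    then have "R = 0"
      using Q2 unfolding b
      by (simp only: div_0 pCons_0_0 mult_zero_left add_0 mult_eq_0_iff) simp
    then have "P = 0"
      by (simp add: R_def pcompose_eq_0_iff)
    then show ?thesis
      using P(3) by (simp add: A B C a b c)
  qed
  ultimately show ?case
    unfolding D_def by blast
qed

section \<open>Uniqueness and the differential recurrences\<close>

text \<open>The polynomial \<open>P\<close> of degree at most \<open>3 * n + 1\<close> would have
  \<open>3 * n + 2\<close> zeros. This is one zero more than the orthogonality conditions for
  \<open>(n, n - 1, n)\<close> provide.\<close>

lemma type1_zero_if_mellin1_vanishes:
  assumes \<nu>: "0 \<le> \<nu>" "\<nu> < 1 / 2"
    and deg: "degree A \<le> n" "degree C \<le> n" "B = 0 \<or> degree B < n"
    and a: "a > 0" and zero: "\<And>m. m \<le> 3 * n + 1 \<Longrightarrow> mellin1 \<nu> A B C (a + real m) = 0"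
  shows "A = 0 \<and> B = 0 \<and> C = 0"
proof -
  obtain P where P: "degree P \<le> 3 * n + 1"
    "\<And>s. s > 0 \<Longrightarrow> mellin1 \<nu> A B C s * poly (mellin_denom \<nu> n) s = mellin1 \<nu> 1 0 0 s * poly P s"
    "P = 0 \<Longrightarrow> A = 0 \<and> B = 0 \<and> C = 0"
    using mellin1_eq_polynomial[OF \<nu> deg] by blast
  define S where "S = (\<lambda>m. a + real m) ` {..3 * n + 1}"
  have "poly P s = 0" if "s \<in> S" for s
  proof -
    have "s > 0" "mellin1 \<nu> A B C s = 0"
      using that a zero by (auto simp: S_def)
    then show ?thesis
      using P(2)[of s] mellin1_pos[OF \<nu>(1), of s] by simp
  qed
  then have "S \<subseteq> {s. poly P s = 0}" by blast
  moreover have "card S = 3 * n + 2"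
    unfolding S_def by (subst card_image) (auto simp: inj_on_def)
  moreover have "card {s. poly P s = 0} \<le> 3 * n + 1" "finite {s. poly P s = 0}" if "P \<noteq> 0"
    using card_poly_roots_bound[OF that] poly_roots_finite[OF that] P(1) by auto
  ultimately have "P = 0"
    using card_mono[of "{s. poly P s = 0}" S] by fastforce
  then show ?thesis
    by (rule P(3))
qed

theorem theorem5:
  fixes \<nu> \<alpha> :: real and n :: nat and A B C A' B' C' :: "real poly"
  assumes "0 \<le> \<nu>" and "\<nu> < 1 / 2" and "n \<ge> 1" and "\<alpha> > 0"
    and "type1_mop \<nu> n (n - 1) \<alpha> A B C"
    and "type1_mop \<nu> n n (\<alpha> - 1) A' B' C'"
  shows "\<exists>c::real. c \<noteq> 0 \<and>
    (\<forall>x>0. ((\<lambda>y. y powr \<alpha> * type1_fun \<nu> A B C y) has_real_derivative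
        x powr (\<alpha> - 1) * type1_fun \<nu> (smult c A') (smult c B') (smult c C') x) (at x)) \<and>
    (\<forall>x. poly (smult c A') x =
        (\<alpha> + 2 * \<nu>) * poly A x + x * poly (pderiv A) x - x * poly C x) \<and>
    (\<forall>x. poly (smult c B') x =
        \<alpha> * poly B x + x * poly (pderiv B) x - poly C x) \<and>
    (\<forall>x. poly (smult c C') x =
        (\<alpha> + \<nu>) * poly C x + x * poly (pderiv C) x - 2 * poly A x - 2 * x * poly B x)"
proof -
  note \<nu> = assms(1,2)
  have q_nz: "\<not> (A = 0 \<and> B = 0 \<and> C = 0)"
    and q_deg: "degree A \<le> n" "degree B \<le> n - 1" "degree C \<le> n - 1"
    and q_int: "\<And>m. m \<le> 2 * n + (n - 1) \<Longrightarrow>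
      ((\<lambda>x. type1_fun \<nu> A B C x * x powr (\<alpha> + real m)) has_integral 0) {0<..}"
    using assms(5) unfolding type1_mop_def by auto
  have q'_nz: "\<not> (A' = 0 \<and> B' = 0 \<and> C' = 0)"
    and q'_deg: "degree A' \<le> n" "degree B' \<le> n - 1" "degree C' \<le> n"
    and q'_int: "\<And>m. m \<le> 2 * n + n \<Longrightarrow>
      ((\<lambda>x. type1_fun \<nu> A' B' C' x * x powr (\<alpha> - 1 + real m)) has_integral 0) {0<..}"
    using assms(6) unfolding type1_mop_def by auto
  define TA where "TA = recA \<nu> \<alpha> A C"
  define TB where "TB = recB \<alpha> B C"
  define TC where "TC = recC \<nu> \<alpha> A B C"
  have T: "mellin1 \<nu> TA TB TC s = (\<alpha> - s) * mellin1 \<nu> A B C s" if "s > 0" for s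
    unfolding TA_def TB_def TC_def using \<nu>(1) that by (rule mellin1_rec)
  have deg_deriv: "degree (pCons 0 (pderiv p)) \<le> degree p" for p :: "real poly"
    by (cases "degree p") (auto simp: degree_pCons_eq_if degree_pderiv pderiv_eq_0_iff)
  \<comment> \<open>Since \<open>n \<ge> 1\<close>, the products of \<open>x\<close> with
    \<open>B\<close> and \<open>C\<close> have degree at most \<open>n\<close>.\<close>
  have deg_shift: "degree (pCons 0 p) \<le> n" if "degree p \<le> n - 1" for p :: "real poly"
    using degree_pCons_le[of 0 p] that assms(3) by linarith
  have TA_deg: "degree TA \<le> n"
    unfolding TA_def recA_def using q_deg deg_deriv[of A] deg_shift[of C]
    by (intro degree_diff_le degree_add_le) auto
  have TB_deg: "degree TB \<le> n - 1"
    unfolding TB_def recB_def using q_deg deg_deriv[of B]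
    by (intro degree_diff_le degree_add_le) auto
  have TC_deg: "degree TC \<le> n"
    unfolding TC_def recC_def using q_deg deg_deriv[of C] deg_shift[of B]
    by (intro degree_diff_le degree_add_le) auto
  \<comment> \<open>The zero at \<open>m = 0\<close> comes from the factor
    \<open>\<alpha> - s\<close>; the zero at \<open>m = Suc k\<close> is the orthogonality condition
    with index \<open>k\<close>.\<close>
  have T_zero: "mellin1 \<nu> TA TB TC (\<alpha> + real m) = 0" if "m \<le> 3 * n" for m
  proof (cases m)
    case 0
    then show ?thesis using T[of \<alpha>] assms(4) by simp
  next
    case (Suc k)
    then have "mellin1 \<nu> A B C (\<alpha> + real m) = 0"
      using q_int[of k] that by (intro mellin1_eqI) simp
    then show ?thesis using T[of "\<alpha> + real m"] assms(4) by simp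
  qed
  \<comment> \<open>With parameter \<open>\<alpha> - 1\<close> the condition of index
    \<open>m\<close> is the zero at \<open>s = \<alpha> + m\<close>, so both triples share these
    \<open>3 * n + 1\<close> zeros.\<close>
  have q'_zero: "mellin1 \<nu> A' B' C' (\<alpha> + real m) = 0" if "m \<le> 3 * n" for m
    using q'_int[of m] that by (intro mellin1_eqI) (simp add: algebra_simps)
  define r where "r = \<alpha> + real (3 * n + 1)"
  have r: "r > 0" using assms(4) by (simp add: r_def)
  \<comment> \<open>\<open>r\<close> is the next node; a zero there as well would make the nonzero
    triple vanish.\<close>
  have q'_r: "mellin1 \<nu> A' B' C' r \<noteq> 0"
  proof
    assume "mellin1 \<nu> A' B' C' r = 0"
    then have "mellin1 \<nu> A' B' C' (\<alpha> + real m) = 0" if "m \<le> 3 * n + 1" for m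
      using that q'_zero[of m] by (cases "m = 3 * n + 1") (auto simp: r_def)
    from type1_zero_if_mellin1_vanishes[OF \<nu> _ _ _ assms(4) this] show False
      using q'_nz q'_deg assms(3) by fastforce
  qed
  \<comment> \<open>Matches the two transforms at \<open>r\<close>, so that the difference of the
    triples vanishes at all \<open>3 * n + 2\<close> nodes.\<close>
  define c where "c = mellin1 \<nu> TA TB TC r / mellin1 \<nu> A' B' C' r"
  have "TA - smult c A' = 0 \<and> TB - smult c B' = 0 \<and> TC - smult c C' = 0"
  proof (rule type1_zero_if_mellin1_vanishes[OF \<nu> _ _ _ assms(4)])
    show "degree (TA - smult c A') \<le> n" "degree (TC - smult c C') \<le> n"
      using TA_deg TC_deg q'_deg by (auto intro!: degree_diff_le)
    have "degree (TB - smult c B') \<le> n - 1"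
      using TB_deg q'_deg by (auto intro!: degree_diff_le)
    then show "TB - smult c B' = 0 \<or> degree (TB - smult c B') < n"
      using assms(3) by linarith
    fix m assume "m \<le> 3 * n + 1"
    have pos: "\<alpha> + real m > 0" using assms(4) by simp
    have "mellin1 \<nu> TA TB TC (\<alpha> + real m) = c * mellin1 \<nu> A' B' C' (\<alpha> + real m)"
    proof (cases "m = 3 * n + 1")
      case True
      then show ?thesis using q'_r by (simp add: c_def r_def)
    next
      case False
      then show ?thesis using T_zero[of m] q'_zero[of m] \<open>m \<le> 3 * n + 1\<close> by simp
    qed
    then show "mellin1 \<nu> (TA - smult c A') (TB - smult c B') (TC - smult c C') (\<alpha> + real m) = 0"
      using mellin1_diff[OF \<nu>(1) pos, of TA "smult c A'" TB "smult c B'" TC "smult c C'"]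
        mellin1_smult[OF \<nu>(1) pos, of c A' B' C'] by simp
  qed
  then have eq: "smult c A' = TA" "smult c B' = TB" "smult c C' = TC"
    by simp_all
  have "c \<noteq> 0"
  proof
    assume "c = 0"
    then have "TA = 0" "TB = 0" "TC = 0" using eq by simp_all
    then have "mellin1 \<nu> TA TB TC s = 0" if "s > 0" for s
      using mellin1_smult[OF \<nu>(1) that, of 0 0 0 0] by simp
    \<comment> \<open>Starting at \<open>\<alpha> + 1\<close> keeps the factor
      \<open>\<alpha> - s\<close> nonzero, so it can be cancelled.\<close>
    then have "mellin1 \<nu> A B C (\<alpha> + 1 + real m) = 0" for m
      using T[of "\<alpha> + 1 + real m"] assms(4) by simp
    then have "A = 0 \<and> B = 0 \<and> C = 0"
      using q_deg assms(3,4)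
      by (intro type1_zero_if_mellin1_vanishes[OF \<nu>, of A n C B "\<alpha> + 1"]) auto
    with q_nz show False ..
  qed
  moreover have "((\<lambda>y. y powr \<alpha> * type1_fun \<nu> A B C y) has_real_derivative
      x powr (\<alpha> - 1) * type1_fun \<nu> (smult c A') (smult c B') (smult c C') x) (at x)" if "x > 0" for x
    unfolding eq TA_def TB_def TC_def using that by (rule has_real_derivative_type1_fun)
  ultimately show ?thesis
    unfolding eq
    by (intro exI[of _ c]) (simp add: eq TA_def TB_def TC_def recA_def recB_def recC_def)
qed

end
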